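(* For each $n\ge 1$ let $(z_1,\dots,z_n)$ be a random vector in $\mathbb{C}^n$ whose joint probability density function (with respect to Lebesgue measure on $\mathbb{C}^n$) is $$C_n\cdot\prod_{1\le j<k\le n}|z_j-z_k|^2\cdot\prod_{k=1}^n\frac{1}{(1+|z_k|^2)^{n+1}},$$ where $C_n$ is a normalizing constant. Define $H_k(x)=e^{-x}\sum_{j=0}^{k-1}\frac{x^j}{j!}$ for $k\ge 1$. Then, as $n\to\infty$, $\frac{1}{\sqrt n}\max_{1\le j\le n}|z_j|$ converges weakly to the probability distribution function $H$ given by $H(x)=\prod_{k=1}^\infty H_k(x^{-2})$ for $x>0$ and $H(x)=0$ for $x\le 0$.
   Context: "$X_n$ converges weakly to the cdf $F$" means that the probability distribution of $X_n$ converges weakly to the probability distribution with cumulative distribution function $F$. The density above is the joint density of the eigenvalues of the spherical ensemble $\mathbf{A}^{-1}\mathbf{B}$, where $\mathbf{A},\mathbf{B}$ are $n\times n$ matrices whose $2n^2$ entries are i.i.d. standard complex normal $\mathbb{C}N(0,1)$ random variables. *)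

theory Defs
  imports "HOL-Probability.Probability"
begin

(* Prefactor-free density on C^n.  Points of C^n are functions on the index set {1..n}; only their
   values on that set matter. *)
definition spherical_weight :: "nat \<Rightarrow> (nat \<Rightarrow> complex) \<Rightarrow> real" where
  "spherical_weight n z =
     (\<Prod>k\<in>{1..n}. \<Prod>j\<in>{1..<k}. (cmod (z j - z k))\<^sup>2) *
     (\<Prod>k\<in>{1..n}. 1 / (1 + (cmod (z k))\<^sup>2) ^ (n + 1))"

definition H_fun :: "nat \<Rightarrow> real \<Rightarrow> real" where
  "H_fun k x = exp (- x) * (\<Sum>j<k. x ^ j / fact j)"

(* prodinf ranges over indices 0, 1, 2, ..., whence the shift by Suc. *)
definition H_cdf :: "real \<Rightarrow> real" where
  "H_cdf x = (if x > 0 then (\<Prod>k. H_fun (Suc k) (1 / x\<^sup>2)) else 0)"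

(* The n-th variable lives on its own space M n.  Membership of F among the cumulative distribution
   functions of probability measures is part of the notion; such a measure is unique (cdf_unique). *)
definition converges_weakly_to_cdf ::
    "(nat \<Rightarrow> 'a measure) \<Rightarrow> (nat \<Rightarrow> 'a \<Rightarrow> real) \<Rightarrow> (real \<Rightarrow> real) \<Rightarrow> bool" where
  "converges_weakly_to_cdf M X F \<longleftrightarrow>
     (\<exists>\<mu>. real_distribution \<mu> \<and> cdf \<mu> = F \<and>
          weak_conv_m (\<lambda>n. distr (M n) borel (X n)) \<mu>)"

(* The value of prodinf is unspecified for divergent products, so convergence matters here. *)
lemma convergent_prod_H_fun:
  assumes "x \<ge> 0"
  shows "convergent_prod (\<lambda>k. H_fun (Suc k) x)"
proof -
  define q where "q k = x ^ k / fact k" for k :: nat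
  have q_nonneg: "q k \<ge> 0" for k
    using assms by (simp add: q_def)
  have bound: "norm (norm (H_fun k x - 1)) \<le> exp x * q k" for k
  proof -
    obtain t where t: "\<bar>t\<bar> \<le> \<bar>x\<bar>"
      and e: "exp x = (\<Sum>m<k. x ^ m / fact m) + exp t / fact k * x ^ k"
      using Maclaurin_exp_le[of x k] by blast
    have "(\<Sum>m<k. x ^ m / fact m) = exp x - exp t * q k"
      using e by (simp add: q_def)
    then have "H_fun k x = exp (- x) * exp x - exp (- x) * (exp t * q k)"
      by (simp only: H_fun_def right_diff_distrib)
    also have "exp (- x) * exp x = 1"
      by (simp flip: exp_add)
    finally have "norm (norm (H_fun k x - 1)) = exp (- x) * (exp t * q k)"
      using q_nonneg[of k] by (simp add: abs_mult)
    also have "\<dots> \<le> 1 * (exp x * q k)"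
    proof (intro mult_mono)
      show "exp t \<le> exp x"
        using assms t by simp
    qed (use assms q_nonneg in simp_all)
    finally show ?thesis by simp
  qed
  have "summable q"
    using summable_exp[of x] unfolding q_def by (simp only: divide_inverse mult.commute)
  then have "summable (\<lambda>k. exp x * q k)"
    by (rule summable_mult)
  then have "summable (\<lambda>k. norm (H_fun k x - 1))"
    by (rule summable_comparison_test') (rule bound)
  then have "summable (\<lambda>k. norm (H_fun (Suc k) x - 1))"
    by (rule iffD2[OF summable_Suc_iff])
  then show ?thesis
    by (intro abs_convergent_prod_imp_convergent_prod summable_imp_abs_convergent_prod)
qed

end

theory Submission
  imports Defs "Jordan_Normal_Form.Determinant"
begin

text \<open>
  The density is the squared modulus of a Vandermonde determinant times a radial product weight.
  Expanding both determinants over permutations and integrating over \<open>{|z\<^sub>1|, \<dots>, |z\<^sub>n| \<le> t}\<close>, rotation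
  invariance leaves only the diagonal terms, so
  \<open>P(max |z\<^sub>j| \<le> t) = (\<Prod>k<n. a\<^sub>k(t) / a\<^sub>k(\<infinity>))\<close> with \<open>a\<^sub>k(t)\<close> the integral of
  \<open>s^k / (1 + s)^(n + 1)\<close> over \<open>[0, t\<^sup>2]\<close>.
  Each factor is a binomial tail; for \<open>t = sqrt n * x\<close> it is the probability that a binomial variable
  with mean close to \<open>x^(-2)\<close> is less than \<open>n - k\<close>. The Poisson limit theorem gives convergence of the
  factors, and a summable bound on their distance to 1 gives convergence of the product. That the
  limit is a distribution function follows because \<open>(\<Prod>k. H\<^sub>k y)\<close> is 1-Lipschitz in \<open>y \<ge> 0\<close>.
\<close>

section \<open>The Vandermonde determinant\<close>

text \<open>The right side is the Leibniz expansion of \<open>det V\<close>. For the left side,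
  \<open>U\<close> is upper triangular with unit diagonal because \<open>f j\<close> is monic of
  degree j, so \<open>det V = det L\<close>; the entries \<open>poly (f j) (z i)\<close> of
  \<open>L\<close> vanish for i < j, and its diagonal multiplies to the product of
  differences.\<close>

lemma vandermonde_sum_permutations:
  fixes z :: "nat \<Rightarrow> 'a::idom"
  shows "(\<Prod>k<n. \<Prod>j<k. z k - z j) =
         (\<Sum>p | p permutes {..<n}. of_int (sign p) * (\<Prod>k<n. z k ^ p k))"
proof -
  \<comment> \<open>The monic polynomials \<open>f j\<close> turn the Vandermonde matrix into a lower triangular one.\<close>
  define f where "f j = (\<Prod>m<j. [:- z m, 1:])" for j
  have deg_f: "degree (f j) = j" for j
    unfolding f_def by (subst degree_prod_eq_sum_degree) auto
  have lead_f: "coeff (f j) j = 1" for j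
    using lead_coeff_prod[of "\<lambda>m. [:- z m, 1:]" "{..<j}"] deg_f[of j] by (simp add: f_def)
  have poly_f: "poly (f j) x = (\<Prod>m<j. x - z m)" for j x
    by (simp add: f_def poly_prod)
  have poly_f_sum: "poly (f j) x = (\<Sum>l = 0..<n. x ^ l * coeff (f j) l)" if "j < n" for j x
  proof -
    have "poly (f j) x = (\<Sum>l\<le>j. coeff (f j) l * x ^ l)"
      by (simp add: poly_altdef deg_f)
    also have "\<dots> = (\<Sum>l = 0..<n. coeff (f j) l * x ^ l)"
      using that deg_f by (intro sum.mono_neutral_left) (auto simp: coeff_eq_0)
    finally show ?thesis by (simp add: mult.commute)
  qed
  define V where "V = mat n n (\<lambda>(i, j). z i ^ j)"
  define U where "U = mat n n (\<lambda>(l, j). coeff (f j) l)"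
  define L where "L = mat n n (\<lambda>(i, j). poly (f j) (z i))"
  have carrier: "V \<in> carrier_mat n n" "U \<in> carrier_mat n n" "L \<in> carrier_mat n n"
    by (simp_all add: V_def U_def L_def)
  have "V * U = L"
    by (rule eq_matI) (auto simp: V_def U_def L_def scalar_prod_def poly_f_sum)
  then have "det V * det U = det L"
    using det_mult[OF carrier(1,2)] by simp
  moreover have "det U = 1"
  proof -
    have "upper_triangular U"
      unfolding upper_triangular_def by (auto intro!: coeff_eq_0 simp: U_def deg_f)
    then have "det U = prod_list (diag_mat U)"
      by (rule det_upper_triangular) (rule carrier)
    also have "\<dots> = (\<Prod>i = 0..<n. U $$ (i, i))"
      using carrier(2) by (simp add: prod_list_diag_prod)
    also have "\<dots> = 1"
      by (intro prod.neutral) (simp add: U_def lead_f)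
    finally show ?thesis .
  qed
  moreover have "det L = (\<Prod>k<n. \<Prod>j<k. z k - z j)"
  proof -
    have "det L = prod_list (diag_mat L)"
    proof (rule det_lower_triangular[OF _ carrier(3)])
      show "L $$ (i, j) = 0" if "i < j" "j < n" for i j
        using that by (auto simp: L_def poly_f)
    qed
    also have "\<dots> = (\<Prod>i = 0..<n. L $$ (i, i))"
      using carrier(3) by (simp add: prod_list_diag_prod)
    also have "\<dots> = (\<Prod>k<n. \<Prod>j<k. z k - z j)"
      by (intro prod.cong) (auto simp: L_def poly_f)
    finally show ?thesis .
  qed
  moreover have "det V = (\<Sum>p | p permutes {..<n}. of_int (sign p) * (\<Prod>k<n. z k ^ p k))"
    unfolding det_def'[OF carrier(1)] atLeast0LessThan
  proof (intro sum.cong refl arg_cong2[where f = times] prod.cong)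
    fix p k assume "p \<in> {p. p permutes {..<n}}" "k \<in> {..<n}"
    then have "k < n" "p k < n"
      using permutes_in_image[of p "{..<n}" k] by auto
    then show "V $$ (k, p k) = z k ^ p k"
      by (simp add: V_def)
  qed
  ultimately show ?thesis by simp
qed

section \<open>Lebesgue measure on the complex plane\<close>

lemma nn_integral_lborel_plus:
  fixes c :: "'a::euclidean_space"
  assumes [measurable]: "f \<in> borel_measurable borel"
  shows "(\<integral>\<^sup>+x. f (c + x) \<partial>lborel) = (\<integral>\<^sup>+x. f x \<partial>lborel)"
proof -
  have "(\<integral>\<^sup>+x. f x \<partial>lborel) = (\<integral>\<^sup>+x. f x \<partial>distr lborel borel ((+) c))"
    by (simp only: lborel_distr_plus)
  also have "\<dots> = (\<integral>\<^sup>+x. f (c + x) \<partial>lborel)"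
    by (subst nn_integral_distr) auto
  finally show ?thesis by simp
qed

lemma lborel_distr_cmult_unit:
  fixes u :: complex
  assumes u: "cmod u = 1"
  shows "distr lborel borel ((*) u) = lborel"
proof (rule measure_eqI)
  fix B assume "B \<in> sets (distr lborel borel ((*) u))"
  then have B[measurable]: "B \<in> sets borel" by simp
  \<comment> \<open>As \<open>A\<close> is invariant under rotation and reflection, Fubini applied to
    \<open>indicator A (u * x) * indicator B (u * x + y)\<close> compares the two measures of \<open>B\<close>.\<close>
  define A where "A = ball (0::complex) 1"
  have A[measurable]: "A \<in> sets borel" by (simp add: A_def)
  have u0: "u \<noteq> 0" using u by auto
  have "emeasure lborel A * emeasure lborel B =
     (\<integral>\<^sup>+x. indicator A (u * x) * emeasure lborel B \<partial>lborel)"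
  proof -
    have "(\<integral>\<^sup>+x. indicator A (u * x) * emeasure lborel B \<partial>lborel) =
        (\<integral>\<^sup>+x. indicator A x * emeasure lborel B \<partial>lborel)"
      by (intro nn_integral_cong) (simp add: A_def indicator_def norm_mult u)
    then show ?thesis
      by (simp add: nn_integral_multc)
  qed
  also have "\<dots> = (\<integral>\<^sup>+x. (\<integral>\<^sup>+y. indicator A (u * x) * indicator B (u * x + y) \<partial>lborel) \<partial>lborel)"
    by (simp add: nn_integral_cmult nn_integral_lborel_plus)
  also have "\<dots> = (\<integral>\<^sup>+y. (\<integral>\<^sup>+x. indicator A (u * x) * indicator B (u * x + y) \<partial>lborel) \<partial>lborel)"
    by (rule lborel_pair.Fubini') simp
  also have "\<dots> = (\<integral>\<^sup>+y. (\<integral>\<^sup>+x. indicator A (u * x - y) * indicator B (u * x) \<partial>lborel) \<partial>lborel)"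
  proof (rule nn_integral_cong)
    \<comment> \<open>Translating x by \<open>y / u\<close> moves the shift y from the argument of
      \<open>B\<close> to that of \<open>A\<close>.\<close>
    fix y :: complex
    show "(\<integral>\<^sup>+x. indicator A (u * x) * indicator B (u * x + y) \<partial>lborel) =
       (\<integral>\<^sup>+x. indicator A (u * x - y) * indicator B (u * x) \<partial>lborel)"
      using nn_integral_lborel_plus[of "\<lambda>x. indicator A (u * x - y) * indicator B (u * x)" "y / u"] u0
      by (simp add: distrib_left add.commute)
  qed
  also have "\<dots> = (\<integral>\<^sup>+x. (\<integral>\<^sup>+y. indicator A (u * x - y) * indicator B (u * x) \<partial>lborel) \<partial>lborel)"
    by (rule lborel_pair.Fubini') simp
  also have "\<dots> = (\<integral>\<^sup>+x. emeasure lborel A * indicator B (u * x) \<partial>lborel)"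
  proof (rule nn_integral_cong)
    \<comment> \<open>\<open>A\<close> is symmetric under negation, so the inner integral over y is
      the area of a translate of \<open>A\<close>, whatever x is.\<close>
    fix x :: complex
    have "(\<integral>\<^sup>+y. indicator A (u * x - y) \<partial>lborel) = (\<integral>\<^sup>+y. indicator A (- (u * x) + y) \<partial>lborel)"
      by (intro nn_integral_cong) (simp add: A_def indicator_def norm_minus_commute)
    also have "\<dots> = emeasure lborel A"
      by (subst nn_integral_lborel_plus) auto
    finally show "(\<integral>\<^sup>+y. indicator A (u * x - y) * indicator B (u * x) \<partial>lborel) =
        emeasure lborel A * indicator B (u * x)"
      by (simp add: nn_integral_multc)
  qed
  also have "\<dots> = emeasure lborel A * emeasure (distr lborel borel ((*) u)) B"
    by (simp add: nn_integral_cmult nn_integral_distr flip: nn_integral_indicator)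
  finally have "emeasure lborel A * emeasure (distr lborel borel ((*) u)) B =
      emeasure lborel A * emeasure lborel B" ..
  \<comment> \<open>The area is positive and finite, so it can be cancelled in
    \<open>ennreal\<close>.\<close>
  moreover have "emeasure lborel A = ennreal pi"
    by (simp add: A_def emeasure_ball unit_ball_vol_2)
  ultimately show "emeasure (distr lborel borel ((*) u)) B = emeasure lborel B"
    by (simp add: ennreal_mult_cancel_left)
qed simp

text \<open>A disc of squared radius a has area pi * a, linear in a, so the density is constant on
  the half-line. The rays \<open>{..a}\<close> generate the Borel sets and are closed under
  intersection, so agreement on them suffices.\<close>

lemma distr_cmod_power2:
  "distr lborel borel (\<lambda>z::complex. (cmod z)\<^sup>2) = density lborel (\<lambda>s. ennreal pi * indicator {0..} s)"
proof (rule measure_eqI_generator_eq)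
  let ?E = "range (\<lambda>a::real. {..a})"
  show "Int_stable ?E"
    by (auto simp: Int_stable_def)
  show "?E \<subseteq> Pow UNIV" by simp
  show "sets (distr lborel borel (\<lambda>z::complex. (cmod z)\<^sup>2)) = sigma_sets UNIV ?E"
    "sets (density lborel (\<lambda>s. ennreal pi * indicator {0..} s)) = sigma_sets UNIV ?E"
    by (simp_all add: borel_eq_atMost)
  let ?A = "\<lambda>n::nat. {..real n}"
  show "range ?A \<subseteq> ?E" by auto
  show "(\<Union>i. ?A i) = UNIV"
    by (auto intro: real_arch_simple)
  have L: "emeasure (distr lborel borel (\<lambda>z::complex. (cmod z)\<^sup>2)) {..a} = ennreal pi * ennreal a" for a
  proof (cases "a \<ge> 0")
    case True
    have "(\<lambda>z::complex. (cmod z)\<^sup>2) -` {..a} = cball 0 (sqrt a)"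
      using True by (auto simp: real_le_rsqrt dest: real_le_lsqrt) (metis norm_ge_zero power_mono real_sqrt_pow2)
    then show ?thesis
      using True by (simp add: emeasure_distr emeasure_cball unit_ball_vol_2 ennreal_mult)
  next
    case False
    then have "(\<lambda>z::complex. (cmod z)\<^sup>2) -` {..a} = {}"
      by (auto dest: order_trans[OF zero_le_power2])
    then show ?thesis
      using False by (simp add: emeasure_distr ennreal_neg)
  qed
  show "emeasure (distr lborel borel (\<lambda>z::complex. (cmod z)\<^sup>2)) (?A i) \<noteq> \<infinity>" for i
    unfolding L by (simp add: ennreal_mult_eq_top_iff)
  fix X assume "X \<in> ?E"
  then obtain a where X: "X = {..a}" by auto
  have "emeasure (density lborel (\<lambda>s. ennreal pi * indicator {0..} s)) {..a} =
      (\<integral>\<^sup>+s. ennreal pi * indicator {0..a} s \<partial>lborel)"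
    by (subst emeasure_density) (auto intro!: nn_integral_cong split: split_indicator)
  also have "\<dots> = ennreal pi * ennreal a"
    by (cases "a \<ge> 0") (auto simp: nn_integral_cmult ennreal_neg)
  finally show "emeasure (distr lborel borel (\<lambda>z::complex. (cmod z)\<^sup>2)) X =
      emeasure (density lborel (\<lambda>s. ennreal pi * indicator {0..} s)) X"
    using L X by simp
qed

text \<open>Polar coordinates with the squared radius s as variable: angle and Jacobian together
  contribute only the constant pi.\<close>

lemma nn_integral_radial:
  assumes [measurable]: "f \<in> borel_measurable borel"
  shows "(\<integral>\<^sup>+z. f ((cmod z)\<^sup>2) \<partial>lborel) = ennreal pi * (\<integral>\<^sup>+s. f s * indicator {0..} s \<partial>lborel)"
proof -
  have "(\<integral>\<^sup>+z. f ((cmod z)\<^sup>2) \<partial>lborel) = (\<integral>\<^sup>+s. f s \<partial>distr lborel borel (\<lambda>z::complex. (cmod z)\<^sup>2))"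
    by (subst nn_integral_distr) auto
  also have "\<dots> = (\<integral>\<^sup>+s. ennreal pi * (f s * indicator {0..} s) \<partial>lborel)"
    unfolding distr_cmod_power2 by (subst nn_integral_density) (auto intro!: nn_integral_cong simp: mult_ac)
  finally show ?thesis
    by (simp add: nn_integral_cmult)
qed

section \<open>Binomial tails and their Poisson limit\<close>

text \<open>The left side is what remains of the numerator when the sum over j <= k, divided by (1 +
  s)^n, is differentiated and a power of 1 + s is cancelled. It telescopes because (k + 1) * C(n, k
  + 1) = (n - k) * C(n, k). The truncated exponent \<open>j - 1\<close> at j = 0 is harmless, since
  the factor \<open>real j\<close> is 0 there.\<close>

lemma tail_sum_derivative:
  fixes s :: real
  assumes "k \<le> n"
  shows "(1 + s) * (\<Sum>j\<le>k. real (n choose j) * (real j * s ^ (j - 1))) -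
           real n * (\<Sum>j\<le>k. real (n choose j) * s ^ j) = - (real (n - k) * real (n choose k) * s ^ k)"
  using assms
proof (induction k)
  case (Suc k)
  have "Suc k * (n choose Suc k) = (n - k) * (n choose k)"
    by (metis binomial_absorb_comp binomial_absorption)
  then have *: "real (n choose Suc k) * (real k + 1) = (real n - real k) * real (n choose k)"
    using Suc.prems by (metis Suc_leD mult.commute of_nat_Suc of_nat_diff of_nat_mult add.commute)
  have "(1 + s) * (\<Sum>j\<le>Suc k. real (n choose j) * (real j * s ^ (j - 1))) -
           real n * (\<Sum>j\<le>Suc k. real (n choose j) * s ^ j)
    = - ((real n - real k) * real (n choose k) * s ^ k) +
      (1 + s) * (real (n choose Suc k) * (real k + 1)) * s ^ k - real n * (real (n choose Suc k) * s ^ Suc k)"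
    using Suc by (simp add: algebra_simps)
  also have "\<dots> = (real (n choose Suc k) * (real k + 1)) * s ^ Suc k - real n * (real (n choose Suc k) * s ^ Suc k)"
    unfolding * by (simp add: algebra_simps)
  also have "\<dots> = - (real (n - Suc k) * real (n choose Suc k) * s ^ Suc k)"
    using Suc.prems by (simp add: algebra_simps of_nat_diff)
  finally show ?case .
qed simp

text \<open>The probability that a binomial variable with parameters \<open>n\<close> and \<open>s / (1 + s)\<close> exceeds \<open>k\<close>.\<close>

definition bin_tail :: "nat \<Rightarrow> nat \<Rightarrow> real \<Rightarrow> real" where
  "bin_tail n k s = (\<Sum>j\<in>{k<..n}. real (n choose j) * s ^ j) / (1 + s) ^ n"

lemma bin_tail_eq:
  assumes "k \<le> n" "s > -1"
  shows "bin_tail n k s = 1 - (\<Sum>j\<le>k. real (n choose j) * s ^ j) / (1 + s) ^ n"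
proof -
  have "(1 + s) ^ n = (\<Sum>j\<le>n. real (n choose j) * s ^ j)"
    using binomial_ring[of s 1 n] by (simp add: add.commute)
  also have "{..n} = {..k} \<union> {k<..n}"
    using assms by auto
  also have "(\<Sum>j\<in>\<dots>. real (n choose j) * s ^ j) =
     (\<Sum>j\<le>k. real (n choose j) * s ^ j) + (\<Sum>j\<in>{k<..n}. real (n choose j) * s ^ j)"
    by (intro sum.union_disjoint) auto
  finally have "(\<Sum>j\<in>{k<..n}. real (n choose j) * s ^ j) = (1 + s) ^ n - (\<Sum>j\<le>k. real (n choose j) * s ^ j)"
    by simp
  then show ?thesis
    using assms by (simp add: bin_tail_def diff_divide_distrib)
qed

text \<open>Makes \<open>bin_tail n k\<close>, up to a constant factor, the antiderivative of the
  radial weight s^k / (1 + s)^(n + 1) that vanishes at 0.\<close>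

lemma DERIV_bin_tail:
  assumes "k < n" "s \<ge> 0"
  shows "(bin_tail n k has_real_derivative
           real (n - k) * real (n choose k) * (s ^ k / (1 + s) ^ (n + 1))) (at s)"
proof -
  define N where "N s = (\<Sum>j\<le>k. real (n choose j) * s ^ j)" for s :: real
  define D where "D = (\<Sum>j\<le>k. real (n choose j) * (real j * s ^ (j - 1)))"
  obtain m where n: "n = Suc m"
    using assms by (cases n) auto
  have "(N has_real_derivative D) (at s)"
    unfolding N_def D_def by (auto intro!: derivative_eq_intros sum.cong)
  moreover have "((\<lambda>s. (1 + s) ^ n) has_real_derivative real n * (1 + s) ^ m) (at s)"
    by (auto intro!: derivative_eq_intros simp: n simp del: power_Suc)
  moreover have "n - Suc 0 = m"
    by (simp add: n)
  ultimately have "((\<lambda>s. 1 - N s / (1 + s) ^ n) has_real_derivative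
      - ((D * (1 + s) ^ n - N s * (real n * (1 + s) ^ m)) / ((1 + s) ^ n * (1 + s) ^ n))) (at s)"
    using assms by (auto intro!: derivative_eq_intros)
  also have "D * (1 + s) ^ n - N s * (real n * (1 + s) ^ m) = (1 + s) ^ m * ((1 + s) * D - real n * N s)"
    by (simp add: n algebra_simps)
  also have "(1 + s) * D - real n * N s = - (real (n - k) * real (n choose k) * s ^ k)"
    unfolding D_def N_def using assms by (intro tail_sum_derivative) simp
  also have "- ((1 + s) ^ m * - (real (n - k) * real (n choose k) * s ^ k) / ((1 + s) ^ n * (1 + s) ^ n))
     = real (n - k) * real (n choose k) * (s ^ k / (1 + s) ^ (n + 1))"
  proof -
    have "- (P * - x / (q * P * (q * P))) = x / (q * (q * P))" if "P > 0" "q > 0" for P q x :: real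
      using that by (simp add: field_simps)
    from this[of "(1 + s) ^ m" "1 + s"] show ?thesis
      using assms by (simp add: n)
  qed
  finally have deriv: "((\<lambda>s. 1 - N s / (1 + s) ^ n) has_real_derivative
     real (n - k) * real (n choose k) * (s ^ k / (1 + s) ^ (n + 1))) (at s)" .
  show ?thesis
  \<comment> \<open>An open set reaching below 0 makes the derivative two-sided at s = 0 as
    well.\<close>
  proof (rule has_field_derivative_transform_within_open[OF deriv, of "{-1<..}"])
    show "1 - N t / (1 + t) ^ n = bin_tail n k t" if "t \<in> {-1<..}" for t
      using that assms unfolding N_def by (subst bin_tail_eq) auto
  qed (use assms in auto)
qed

lemma bin_tail_0: "bin_tail n k 0 = 0"
  by (simp add: bin_tail_def)

lemma tendsto_bin_tail_at_top:
  assumes "k < n"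
  shows "(bin_tail n k \<longlongrightarrow> 1) at_top"
proof -
  \<comment> \<open>Since j <= k < n, the denominator has a spare factor 1 + s, which squeezes every
    term of the complementary sum to 0.\<close>
  have "((\<lambda>s::real. s ^ j / (1 + s) ^ n) \<longlongrightarrow> 0) at_top" if "j \<le> k" for j
  proof (rule tendsto_sandwich)
    show "\<forall>\<^sub>F s::real in at_top. 0 \<le> s ^ j / (1 + s) ^ n"
      using eventually_ge_at_top[of 0] by eventually_elim simp
    show "\<forall>\<^sub>F s::real in at_top. s ^ j / (1 + s) ^ n \<le> inverse (1 + s)"
      using eventually_ge_at_top[of 0]
    proof eventually_elim
      case (elim s)
      obtain m where m: "n = Suc m" "j \<le> m"
        using assms \<open>j \<le> k\<close> by (cases n) auto
      have "s ^ j \<le> (1 + s) ^ j"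
        using elim by (intro power_mono) auto
      also have "\<dots> \<le> (1 + s) ^ m"
        using elim m by (intro power_increasing) auto
      finally have "s ^ j / (1 + s) ^ m \<le> 1"
        using elim by (simp add: divide_le_eq)
      then have "s ^ j / (1 + s) ^ m * inverse (1 + s) \<le> 1 * inverse (1 + s)"
        using elim by (intro mult_right_mono) auto
      then show ?case
        by (simp add: m divide_inverse mult_ac)
    qed
    show "((\<lambda>s::real. inverse (1 + s)) \<longlongrightarrow> 0) at_top"
      by (intro tendsto_inverse_0_at_top filterlim_tendsto_add_at_top[OF tendsto_const] filterlim_ident)
  qed auto
  then have "((\<lambda>s::real. 1 - (\<Sum>j\<le>k. real (n choose j) * (s ^ j / (1 + s) ^ n))) \<longlongrightarrow>
      1 - (\<Sum>j\<le>k. real (n choose j) * 0)) at_top"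
    by (intro tendsto_intros) auto
  then have "((\<lambda>s::real. 1 - (\<Sum>j\<le>k. real (n choose j) * (s ^ j / (1 + s) ^ n))) \<longlongrightarrow> 1) at_top"
    by simp
  then show ?thesis
  proof (rule Lim_transform_eventually)
    show "\<forall>\<^sub>F s in at_top. 1 - (\<Sum>j\<le>k. real (n choose j) * (s ^ j / (1 + s) ^ n)) = bin_tail n k s"
      using eventually_gt_at_top[of "-1"]
      by eventually_elim (use assms in \<open>simp add: bin_tail_eq sum_divide_distrib\<close>)
  qed
qed

text \<open>The probability that a binomial variable with parameters \<open>n\<close> and \<open>y / (n + y)\<close> is less than \<open>m\<close>.\<close>

definition bin_head :: "nat \<Rightarrow> nat \<Rightarrow> real \<Rightarrow> real" where
  "bin_head n m y = (\<Sum>i<m. real (n choose i) / real n ^ i * y ^ i) / (1 + y / real n) ^ n"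

text \<open>Exchanging successes and failures: i = n - j reverses the sum, the odds n / y become y /
  n, and the factor (n / y)^n common to numerator and denominator cancels.\<close>

lemma bin_tail_eq_bin_head:
  assumes "k < n" "y > 0"
  shows "bin_tail n k (real n / y) = bin_head n (n - k) y"
proof -
  have "(\<Sum>j\<in>{k<..n}. real (n choose j) * (real n / y) ^ j) =
     (\<Sum>i<n - k. real (n choose i) * (real n / y) ^ (n - i))"
    by (rule sum.reindex_bij_witness[of _ "\<lambda>i. n - i" "\<lambda>j. n - j"])
      (use assms in \<open>auto simp flip: binomial_symmetric\<close>)
  also have "\<dots> = (\<Sum>i<n - k. (real n / y) ^ n * (real (n choose i) / real n ^ i * y ^ i))"
    using assms by (intro sum.cong) (auto simp: power_diff field_simps)
  also have "\<dots> = (real n / y) ^ n * (\<Sum>i<n - k. real (n choose i) / real n ^ i * y ^ i)"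
    by (simp add: sum_distrib_left)
  finally have *: "(\<Sum>j\<in>{k<..n}. real (n choose j) * (real n / y) ^ j) = \<dots>" .
  have "1 + real n / y = (real n / y) * (1 + y / real n)"
    using assms by (simp add: field_simps)
  then have "(1 + real n / y) ^ n = (real n / y) ^ n * (1 + y / real n) ^ n"
    by (simp only: power_mult_distrib)
  with * show ?thesis
    using assms by (simp add: bin_tail_def bin_head_def)
qed

section \<open>Uniform bounds and the Poisson limit\<close>

lemma power_1_plus_eq_sum:
  assumes "n > 0"
  shows "(1 + y / real n) ^ n = (\<Sum>i\<le>n. real (n choose i) / real n ^ i * y ^ i)"
  using binomial_ring[of "y / real n" 1 n] assms by (simp add: power_divide add.commute)

lemma choose_div_power_le: "real (n choose i) / real n ^ i \<le> 1 / fact i"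
proof (cases "i \<le> n")
  case True
  have "real (n choose i) * fact i \<le> real n ^ i"
    using binomial_fact_pow[of n i] by (metis of_nat_fact of_nat_le_iff of_nat_mult of_nat_power)
  with True show ?thesis
    by (cases "n = 0") (auto simp: field_simps)
qed (simp add: binomial_eq_0)

lemma exp_tail_summable: "(x::real) \<ge> 0 \<Longrightarrow> summable (\<lambda>k. exp x * (x ^ k / fact k))"
  using summable_exp[of x] by (intro summable_mult) (simp add: divide_inverse mult.commute)

text \<open>The third bound does not depend on n, so it can dominate in
  \<open>prod_bin_head_tendsto\<close>. The terms missing from the full binomial sum
  \<open>P\<close> are at most those of the exponential series, whose remainder has the Lagrange
  form; dividing by \<open>P\<close>, which is at least 1, only helps.\<close>

lemma bin_head_bounds:
  assumes "n > 0" "y \<ge> 0"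
  shows "0 \<le> bin_head n m y" "bin_head n m y \<le> 1" "1 - bin_head n m y \<le> exp y * (y ^ m / fact m)"
proof -
  let ?a = "\<lambda>i. real (n choose i) / real n ^ i * y ^ i"
  define P where "P = (1 + y / real n) ^ n"
  have P: "P = (\<Sum>i\<le>n. ?a i)" "P \<ge> 1"
    using assms unfolding P_def by (simp_all add: one_le_power power_1_plus_eq_sum[OF assms(1), symmetric] del: times_divide_eq_left)
  \<comment> \<open>Terms with i > n vanish, so the range may be enlarged to contain
    \<open>{..<m}\<close> even when m exceeds n + 1.\<close>
  have P': "P = (\<Sum>i<max m (Suc n). ?a i)"
    unfolding P(1) by (intro sum.mono_neutral_left) auto
  have a_nonneg: "?a i \<ge> 0" for i
    using assms by simp
  show "0 \<le> bin_head n m y"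
    unfolding bin_head_def using assms by (intro divide_nonneg_nonneg sum_nonneg) auto
  have "(\<Sum>i<m. ?a i) \<le> P"
    unfolding P' using a_nonneg by (intro sum_mono2) auto
  then show "bin_head n m y \<le> 1"
    using P(2) by (simp add: bin_head_def P_def[symmetric])
  have "P - (\<Sum>i<m. ?a i) = (\<Sum>i\<in>{m..<max m (Suc n)}. ?a i)"
    unfolding P' using sum.atLeastLessThan_concat[of 0 m "max m (Suc n)" ?a]
    by (simp add: atLeast0LessThan)
  also have "\<dots> \<le> (\<Sum>i\<in>{m..<max m (Suc n)}. y ^ i / fact i)"
    using assms choose_div_power_le[of n] by (intro sum_mono) (metis mult_right_mono times_divide_eq_left mult_1 zero_le_power)
  also have "\<dots> = (\<Sum>i<max m (Suc n). y ^ i / fact i) - (\<Sum>i<m. y ^ i / fact i)"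
    using sum.atLeastLessThan_concat[of 0 m "max m (Suc n)" "\<lambda>i. y ^ i / fact i"]
    by (simp add: atLeast0LessThan)
  also have "\<dots> \<le> exp y - (\<Sum>i<m. y ^ i / fact i)"
  proof -
    have "(\<Sum>i<max m (Suc n). y ^ i / fact i) \<le> (\<Sum>i. y ^ i / fact i)"
      using summable_exp[of y] assms
      by (intro sum_le_suminf) (auto simp: divide_inverse mult.commute)
    also have "\<dots> = exp y"
      by (simp add: exp_def divide_inverse mult.commute)
    finally show ?thesis by simp
  qed
  also have "\<dots> \<le> exp y * (y ^ m / fact m)"
  proof -
    obtain t where t: "\<bar>t\<bar> \<le> \<bar>y\<bar>"
      and e: "exp y = (\<Sum>m<m. y ^ m / fact m) + exp t / fact m * y ^ m"
      using Maclaurin_exp_le[of y m] by blast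
    have "exp t / fact m * y ^ m \<le> exp y / fact m * y ^ m"
      using t assms by (intro mult_right_mono divide_right_mono) auto
    with e show ?thesis by simp
  qed
  finally have *: "P - (\<Sum>i<m. ?a i) \<le> exp y * (y ^ m / fact m)" .
  have "1 - bin_head n m y = (P - (\<Sum>i<m. ?a i)) / P"
    using P(2) by (simp add: bin_head_def P_def[symmetric] field_simps)
  also have "\<dots> \<le> P - (\<Sum>i<m. ?a i)"
    using \<open>(\<Sum>i<m. ?a i) \<le> P\<close> P(2) by (simp add: divide_le_eq mult_left_le mult_le_cancel_left1)
  finally show "1 - bin_head n m y \<le> exp y * (y ^ m / fact m)"
    using * by linarith
qed

text \<open>The quotient of the terms for i + 1 and i is (1 - i / n) / (i + 1), which tends to 1 /
  (i + 1).\<close>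

lemma choose_div_power_tendsto: "(\<lambda>n. real (n choose i) / real n ^ i) \<longlonglongrightarrow> 1 / fact i"
proof (induction i)
  case (Suc i)
  have "(\<lambda>n. (1 - real i / real n) / (real i + 1)) \<longlonglongrightarrow> (1 - 0) / (real i + 1)"
    by (intro tendsto_intros) auto
  from tendsto_mult[OF Suc this]
  have "(\<lambda>n. real (n choose i) / real n ^ i * ((1 - real i / real n) / (real i + 1))) \<longlonglongrightarrow> 1 / fact (Suc i)"
    by (simp add: field_simps)
  then show ?case
  proof (rule Lim_transform_eventually)
    show "\<forall>\<^sub>F n in sequentially. real (n choose i) / real n ^ i * ((1 - real i / real n) / (real i + 1)) =
        real (n choose Suc i) / real n ^ Suc i"
      using eventually_gt_at_top[of i]
    proof eventually_elim
      case (elim n)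
      have "Suc i * (n choose Suc i) = (n - i) * (n choose i)"
        by (metis binomial_absorb_comp binomial_absorption)
      then have "(real i + 1) * real (n choose Suc i) = (real n - real i) * real (n choose i)"
        using elim by (metis less_imp_le of_nat_Suc of_nat_diff of_nat_mult add.commute)
      then have "real (n choose Suc i) = (real n - real i) * real (n choose i) / (real i + 1)"
        by (simp add: field_simps)
      moreover have "1 - real i / real n = (real n - real i) / real n"
        using elim by (simp add: field_simps)
      ultimately show ?case
        by (simp add: mult_ac)
    qed
  qed
qed simp

text \<open>Poisson limit theorem: for fixed m the finite sum converges termwise and the denominator
  tends to exp y.\<close>

lemma bin_head_tendsto: "(\<lambda>n. bin_head n m y) \<longlonglongrightarrow> H_fun m y"
proof -
  have "(\<lambda>n. bin_head n m y) \<longlonglongrightarrow> (\<Sum>i<m. 1 / fact i * y ^ i) / exp y"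
    unfolding bin_head_def
    by (intro tendsto_intros choose_div_power_tendsto tendsto_exp_limit_sequentially) auto
  then show ?thesis
    by (simp add: H_fun_def exp_minus field_simps)
qed

lemma H_fun_bounds:
  assumes "y \<ge> 0"
  shows "0 \<le> H_fun m y" "H_fun m y \<le> 1" "1 - H_fun m y \<le> exp y * (y ^ m / fact m)"
proof -
  have ev: "\<forall>\<^sub>F n in sequentially. 0 < (n::nat)"
    by (rule eventually_gt_at_top)
  show "0 \<le> H_fun m y"
    by (rule tendsto_lowerbound[OF bin_head_tendsto eventually_mono[OF ev]])
      (use bin_head_bounds(1) assms in blast, simp)
  show "H_fun m y \<le> 1"
    by (rule tendsto_upperbound[OF bin_head_tendsto eventually_mono[OF ev]])
      (use bin_head_bounds(2) assms in blast, simp)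
  show "1 - H_fun m y \<le> exp y * (y ^ m / fact m)"
    by (rule tendsto_upperbound[OF tendsto_diff[OF tendsto_const bin_head_tendsto] eventually_mono[OF ev]])
      (use bin_head_bounds(3) assms in blast, simp)
qed

section \<open>Convergence of the product over all factors\<close>

lemma prod_H_fun_tendsto:
  assumes "y \<ge> 0"
  shows "(\<lambda>n. \<Prod>k<n. H_fun (Suc k) y) \<longlonglongrightarrow> (\<Prod>k. H_fun (Suc k) y)"
  using convergent_prod_LIMSEQ[OF convergent_prod_H_fun[OF assms]]
  by (simp add: LIMSEQ_lessThan_iff_atMost)

text \<open>Both the factors and their number change with n. Products of numbers in [0, 1] differ by
  at most the sum of the differences of their factors, and Tannery's theorem sends that sum to 0
  under the summable bound \<open>B\<close>.\<close>

lemma prod_bin_head_tendsto: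
  assumes "y \<ge> 0"
  shows "(\<lambda>n. \<Prod>k<n. bin_head n (Suc k) y) \<longlonglongrightarrow> (\<Prod>k. H_fun (Suc k) y)"
proof -
  define d where "d k n = \<bar>bin_head n (Suc k) y - H_fun (Suc k) y\<bar>" for k n
  define B where "B k = exp y * (y ^ Suc k / fact (Suc k))" for k
  have d_le: "d k n \<le> B k" if "n > 0" for k n
    using bin_head_bounds[OF that assms, of "Suc k"] H_fun_bounds[OF assms, of "Suc k"]
    unfolding d_def B_def by linarith
  have d_abs: "\<bar>d k n\<bar> = d k n" for k n
    by (simp add: d_def)
  have "summable B"
    unfolding B_def using exp_tail_summable[OF assms] by (subst summable_Suc_iff)
  have "(\<lambda>n. d k n) \<longlonglongrightarrow> 0" for k
    unfolding d_def using bin_head_tendsto[of "Suc k" y]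
    by (intro tendsto_rabs_zero) (simp add: LIM_zero_iff)
  then have "(\<lambda>n. suminf (\<lambda>k. d k n)) \<longlonglongrightarrow> suminf (\<lambda>k. 0)"
  proof (intro conjunct2[OF conjunct2[OF tannerys_theorem]])
    show "\<forall>\<^sub>F (k, n) in sequentially \<times>\<^sub>F sequentially. norm (d k n) \<le> B k"
      using eventually_prodI[OF eventually_gt_at_top[of "0::nat"] eventually_gt_at_top[of "0::nat"]]
      by (rule eventually_mono) (auto simp: d_abs d_le)
  qed (use \<open>summable B\<close> in auto)
  then have lim: "(\<lambda>n. suminf (\<lambda>k. d k n)) \<longlonglongrightarrow> 0"
    by simp
  have "(\<lambda>n. (\<Prod>k<n. bin_head n (Suc k) y) - (\<Prod>k<n. H_fun (Suc k) y)) \<longlonglongrightarrow> 0"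
  proof (rule Lim_null_comparison[OF _ lim])
    show "\<forall>\<^sub>F n in sequentially. norm ((\<Prod>k<n. bin_head n (Suc k) y) - (\<Prod>k<n. H_fun (Suc k) y)) \<le> suminf (\<lambda>k. d k n)"
      using eventually_gt_at_top[of 0]
    proof eventually_elim
      case (elim n)
      have "norm ((\<Prod>k<n. bin_head n (Suc k) y) - (\<Prod>k<n. H_fun (Suc k) y)) \<le> (\<Sum>k<n. d k n)"
        using norm_prod_diff[of "{..<n}" "\<lambda>k. bin_head n (Suc k) y" "\<lambda>k. H_fun (Suc k) y"]
          bin_head_bounds[OF elim assms] H_fun_bounds[OF assms]
        by (simp add: d_def abs_le_iff)
      also have "\<dots> \<le> suminf (\<lambda>k. d k n)"
      proof (rule sum_le_suminf)
        show "summable (\<lambda>k. d k n)"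
          using d_le[OF elim] by (intro summable_comparison_test'[OF \<open>summable B\<close>]) (auto simp: d_def)
      qed (auto simp: d_def)
      finally show ?case .
    qed
  qed
  from tendsto_add[OF this prod_H_fun_tendsto[OF assms]] show ?thesis
    by simp
qed

section \<open>The limiting distribution function\<close>

lemma H_fun_Suc: "H_fun (Suc k) y = H_fun k y + exp (- y) * (y ^ k / fact k)"
  by (simp add: H_fun_def algebra_simps)

text \<open>\<open>H_fun (Suc k)\<close> is the Poisson distribution function at k; the derivatives
  of the Poisson masses telescope, leaving minus the last mass.\<close>

lemma DERIV_H_fun_Suc:
  "(H_fun (Suc k) has_real_derivative - (exp (- y) * (y ^ k / fact k))) (at y)"
proof (induction k)
  case 0
  show ?case
    by (auto simp: H_fun_def fun_eq_iff intro!: derivative_eq_intros)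
next
  case (Suc k)
  have "((\<lambda>y. H_fun (Suc k) y + exp (- y) * (y ^ Suc k / fact (Suc k))) has_real_derivative
     - (exp (- y) * (y ^ k / fact k)) +
       (exp (- y) * (real (Suc k) * y ^ k / fact (Suc k)) - exp (- y) * (y ^ Suc k / fact (Suc k)))) (at y)"
    by (rule derivative_eq_intros Suc refl | simp)+
  also have "real (Suc k) * y ^ k / fact (Suc k) = y ^ k / fact k"
    by (simp add: fact_Suc del: of_nat_Suc)
  finally show ?case
    by (subst (asm) H_fun_Suc[symmetric]) simp
qed

lemma H_fun_antimono:
  assumes "0 \<le> y" "y \<le> y'"
  shows "H_fun (Suc k) y' \<le> H_fun (Suc k) y"
  by (rule DERIV_nonpos_imp_nonincreasing[OF assms(2)])
    (use assms DERIV_H_fun_Suc in fastforce)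

text \<open>The derivatives of the first n factors sum to minus \<open>H_fun n t\<close>, which is
  at least -1, so t plus the sum of the factors is nondecreasing. The bound is uniform in n and so
  survives the limit in \<open>H_prod_diff_le\<close>.\<close>

lemma sum_H_fun_diff_le:
  assumes "0 \<le> y" "y \<le> y'"
  shows "(\<Sum>k<n. H_fun (Suc k) y - H_fun (Suc k) y') \<le> y' - y"
proof -
  define g where "g t = t + (\<Sum>k<n. H_fun (Suc k) t)" for t
  have "g y \<le> g y'"
  proof (rule DERIV_nonneg_imp_nondecreasing[OF assms(2)])
    fix t assume t: "y \<le> t" "t \<le> y'"
    have "(g has_real_derivative 1 + (\<Sum>k<n. - (exp (- t) * (t ^ k / fact k)))) (at t)"
      unfolding g_def by (intro derivative_intros DERIV_H_fun_Suc)
    also have "1 + (\<Sum>k<n. - (exp (- t) * (t ^ k / fact k))) = 1 - H_fun n t"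
      by (simp add: H_fun_def sum_negf sum_distrib_left)
    finally show "\<exists>d. (g has_real_derivative d) (at t) \<and> 0 \<le> d"
      using H_fun_bounds(2)[of t n] t assms by (intro exI[of _ "1 - H_fun n t"]) auto
  qed
  then show ?thesis
    by (simp add: g_def sum_subtractf)
qed

text \<open>The limit law in the variable y = 1 / x^2; the value at y = 0 represents x tending to
  infinity.\<close>

definition H_prod :: "real \<Rightarrow> real" where
  "H_prod y = (\<Prod>k. H_fun (Suc k) y)"

lemma H_prod_antimono:
  assumes "0 \<le> y" "y \<le> y'"
  shows "H_prod y' \<le> H_prod y"
  unfolding H_prod_def
proof (rule LIMSEQ_le[OF prod_H_fun_tendsto prod_H_fun_tendsto])
  show "\<exists>N. \<forall>n\<ge>N. (\<Prod>k<n. H_fun (Suc k) y') \<le> (\<Prod>k<n. H_fun (Suc k) y)"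
    using assms by (intro exI allI impI prod_mono conjI H_fun_antimono H_fun_bounds) auto
qed (use assms in auto)

lemma H_prod_diff_le:
  assumes "0 \<le> y" "y \<le> y'"
  shows "H_prod y - H_prod y' \<le> y' - y"
  unfolding H_prod_def
proof (rule LIMSEQ_le_const2[OF tendsto_diff[OF prod_H_fun_tendsto prod_H_fun_tendsto]])
  have "(\<Prod>k<n. H_fun (Suc k) y) - (\<Prod>k<n. H_fun (Suc k) y') \<le> y' - y" for n
  proof -
    have "norm ((\<Prod>k<n. H_fun (Suc k) y) - (\<Prod>k<n. H_fun (Suc k) y')) \<le>
        (\<Sum>k<n. norm (H_fun (Suc k) y - H_fun (Suc k) y'))"
      using assms H_fun_bounds by (intro norm_prod_diff) (auto simp: abs_le_iff intro: order_trans[of _ 0])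
    also have "\<dots> = (\<Sum>k<n. H_fun (Suc k) y - H_fun (Suc k) y')"
      using H_fun_antimono[OF assms] by simp
    also have "\<dots> \<le> y' - y"
      by (rule sum_H_fun_diff_le[OF assms])
    finally show ?thesis by simp
  qed
  then show "\<exists>N. \<forall>n\<ge>N. (\<Prod>k<n. H_fun (Suc k) y) - (\<Prod>k<n. H_fun (Suc k) y') \<le> y' - y"
    by blast
qed (use assms in auto)

lemma H_prod_0: "H_prod 0 = 1"
proof -
  have "H_fun (Suc k) 0 = 1" for k
    by (induction k) (simp_all add: H_fun_Suc[of "Suc _"], simp add: H_fun_def)
  then show ?thesis
    by (simp add: H_prod_def)
qed

text \<open>The first factor is exp (- y) and the others are at most 1. This decay gives
  right-continuity of \<open>H_cdf\<close> at 0.\<close>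

lemma H_prod_le_exp:
  assumes "y \<ge> 0"
  shows "H_prod y \<le> exp (- y)"
  unfolding H_prod_def
proof (rule LIMSEQ_le_const2[OF prod_H_fun_tendsto[OF assms]])
  have "(\<Prod>k<n. H_fun (Suc k) y) \<le> exp (- y)" if n1: "n \<ge> 1" for n
  proof -
    obtain m where n: "n = Suc m"
      using n1 by (cases n) auto
    have "(\<Prod>k<n. H_fun (Suc k) y) = exp (- y) * (\<Prod>k<m. H_fun (Suc (Suc k)) y)"
      unfolding n by (subst prod.lessThan_Suc_shift) (simp add: H_fun_def)
    also have "\<dots> \<le> exp (- y) * 1"
      using assms by (intro mult_left_mono prod_le_1) (auto simp: H_fun_bounds)
    finally show ?thesis by simp
  qed
  then show "\<exists>N. \<forall>n\<ge>N. (\<Prod>k<n. H_fun (Suc k) y) \<le> exp (- y)"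
    by blast
qed

lemma H_prod_nonneg:
  assumes "y \<ge> 0"
  shows "0 \<le> H_prod y"
  unfolding H_prod_def
  using assms
  by (intro LIMSEQ_le_const[OF prod_H_fun_tendsto[OF assms]] exI allI impI prod_nonneg)
    (auto simp: H_fun_bounds)

lemma H_cdf_eq: "H_cdf x = (if x > 0 then H_prod (1 / x\<^sup>2) else 0)"
  by (simp add: H_cdf_def H_prod_def)

lemma continuous_on_H_prod: "continuous_on {0..} H_prod"
proof (rule lipschitz_on_continuous_on[of 1])
  show "1-lipschitz_on {0..} H_prod"
  proof (rule lipschitz_onI)
    fix x y :: real assume "x \<in> {0..}" "y \<in> {0..}"
    then show "dist (H_prod x) (H_prod y) \<le> 1 * dist x y"
      using H_prod_diff_le[of x y] H_prod_diff_le[of y x] H_prod_antimono[of x y] H_prod_antimono[of y x]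
      by (cases "x \<le> y") (auto simp: dist_real_def)
  qed simp
qed

text \<open>The witness is the Lebesgue-Stieltjes measure of \<open>H_cdf\<close>, which calls for
  monotonicity, right-continuity and the limits at both ends.\<close>

lemma real_distribution_H_cdf: "\<exists>\<mu>. real_distribution \<mu> \<and> cdf \<mu> = H_cdf"
proof (intro exI conjI)
  have mono: "H_cdf x \<le> H_cdf y" if "x \<le> y" for x y
    using that by (auto simp: H_cdf_eq H_prod_nonneg intro!: H_prod_antimono divide_left_mono power_mono)
  have cont: "continuous (at_right a) H_cdf" for a
  proof -
    \<comment> \<open>The two branches of \<open>H_cdf\<close> meet at 0; any other point has a
      whole neighbourhood inside one branch.\<close>
    consider "a < 0" | "a = 0" | "a > 0" by linarith
    then show ?thesis
    proof cases
      case 1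
      have "isCont H_cdf a"
        using 1 by (subst isCont_cong[of _ "\<lambda>_. 0"])
          (auto simp: H_cdf_eq eventually_nhds intro!: exI[of _ "{..<0}"])
      then show ?thesis by (rule continuous_at_imp_continuous_at_within)
    next
      case 2
      have "(H_cdf \<longlongrightarrow> 0) (at_right 0)"
      proof (rule tendsto_sandwich)
        show "\<forall>\<^sub>F x in at_right 0. 0 \<le> H_cdf x"
          by (simp add: H_cdf_eq H_prod_nonneg)
        show "\<forall>\<^sub>F x in at_right 0. H_cdf x \<le> exp (- (1 / x\<^sup>2))"
          using eventually_at_right_less[of 0]
          by eventually_elim (use H_prod_le_exp in \<open>auto simp: H_cdf_eq\<close>)
        have "filterlim (\<lambda>x::real. 1 / x\<^sup>2) at_top (at_right 0)"
          unfolding divide_inverse mult_1_left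
          by (rule filterlim_compose[OF filterlim_inverse_at_top_right])
             (auto simp: filterlim_at eventually_at_filter intro!: tendsto_eq_intros)
        then show "((\<lambda>x::real. exp (- (1 / x\<^sup>2))) \<longlongrightarrow> 0) (at_right 0)"
          by (intro filterlim_compose[OF exp_at_bot] filterlim_uminus_at_top[THEN iffD1])
      qed auto
      then show ?thesis
        using 2 by (simp add: continuous_within H_cdf_eq)
    next
      case 3
      have "continuous_on {0<..} (\<lambda>x. H_prod (1 / x\<^sup>2))"
        by (intro continuous_on_compose2[OF continuous_on_H_prod] continuous_intros) auto
      then have "continuous_on {0<..} H_cdf"
        by (rule continuous_on_eq) (simp add: H_cdf_eq)
      then have "isCont H_cdf a"
        using 3 by (simp add: continuous_on_eq_continuous_at)
      then show ?thesis by (rule continuous_at_imp_continuous_at_within)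
    qed
  qed
  have bot: "(H_cdf \<longlongrightarrow> 0) at_bot"
    by (rule tendsto_eventually) (use eventually_le_at_bot[of 0] in \<open>eventually_elim, simp add: H_cdf_eq\<close>)
  have top: "(H_cdf \<longlongrightarrow> 1) at_top"
  proof (rule tendsto_sandwich)
    \<comment> \<open>The 1-Lipschitz bound between 0 and 1 / x^2, with
      \<open>H_prod 0 = 1\<close>.\<close>
    show "\<forall>\<^sub>F x in at_top. 1 - inverse (x\<^sup>2) \<le> H_cdf x"
      using eventually_gt_at_top[of 0]
    proof eventually_elim
      case (elim x)
      then show ?case
        using H_prod_diff_le[of 0 "1 / x\<^sup>2"] by (simp add: H_cdf_eq H_prod_0 divide_inverse)
    qed
    show "\<forall>\<^sub>F x in at_top. H_cdf x \<le> 1"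
      using H_prod_antimono[of 0] by (simp add: H_cdf_eq H_prod_0)
    have "((\<lambda>x::real. 1 - inverse (x\<^sup>2)) \<longlongrightarrow> 1 - 0) at_top"
      by (intro tendsto_intros tendsto_inverse_0_at_top filterlim_pow_at_top filterlim_ident) auto
    then show "((\<lambda>x::real. 1 - inverse (x\<^sup>2)) \<longlongrightarrow> 1) at_top"
      by simp
  qed auto
  show "real_distribution (interval_measure H_cdf)"
    by (intro real_distribution_interval_measure mono cont bot top)
  show "cdf (interval_measure H_cdf) = H_cdf"
    by (intro cdf_interval_measure mono cont bot)
qed

section \<open>Integrals of the joint density\<close>

text \<open>The set \<open>E\<close> restricts the squared modulus: \<open>{..s}\<close> for the event, \<open>UNIV\<close> for the normalizing constant.\<close>

definition spherical_factor :: "nat \<Rightarrow> real set \<Rightarrow> complex \<Rightarrow> real" where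
  "spherical_factor n E z = indicator E ((cmod z)\<^sup>2) / (1 + (cmod z)\<^sup>2) ^ (n + 1)"

lemma spherical_factor_nonneg: "spherical_factor n E z \<ge> 0"
  by (simp add: spherical_factor_def)

lemma borel_measurable_spherical_factor [measurable]:
  "E \<in> sets borel \<Longrightarrow> spherical_factor n E \<in> borel_measurable borel"
  unfolding spherical_factor_def
  by (intro borel_measurable_divide measurable_compose[OF _ borel_measurable_indicator]
      borel_measurable_power) auto

section \<open>Radial moments\<close>

lemma DERIV_bin_tail_div:
  assumes "k < n" "s \<ge> 0"
  shows "((\<lambda>s. bin_tail n k s / (real (n - k) * real (n choose k))) has_real_derivative
           s ^ k / (1 + s) ^ (n + 1)) (at s)"
  using DERIV_cdivide[OF DERIV_bin_tail[OF assms], of "real (n - k) * real (n choose k)"] assms(1)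
  by simp

lemma bin_tail_nonneg: "s \<ge> 0 \<Longrightarrow> bin_tail n k s \<ge> 0"
  by (simp add: bin_tail_def sum_nonneg)

text \<open>For k < n this is pi times the Beta integral B(k + 1, n - k) = k! (n - k - 1)! /
  n!.\<close>

definition beta_const :: "nat \<Rightarrow> nat \<Rightarrow> real" where
  "beta_const n k = pi / (real (n - k) * real (n choose k))"

lemma beta_const_pos: "k < n \<Longrightarrow> beta_const n k > 0"
  by (simp add: beta_const_def)

text \<open>In s = |z|^2 the integrand is s^k / (1 + s)^(n + 1), with a multiple of
  \<open>bin_tail n k\<close> as antiderivative; its limit 1 at infinity, up to that multiple, gives
  the second integral.\<close>

lemma nn_integral_moment:
  assumes "k < n"
  shows "s \<ge> 0 \<Longrightarrow> (\<integral>\<^sup>+z. ennreal (cmod z ^ (2 * k) * spherical_factor n {..s} z) \<partial>lborel) =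
           ennreal (beta_const n k * bin_tail n k s)"
    and "(\<integral>\<^sup>+z. ennreal (cmod z ^ (2 * k) * spherical_factor n UNIV z) \<partial>lborel) =
           ennreal (beta_const n k)"
proof -
  let ?f = "\<lambda>s::real. s ^ k / (1 + s) ^ (n + 1)"
  let ?F = "\<lambda>s. bin_tail n k s / (real (n - k) * real (n choose k))"
  have radial: "(\<integral>\<^sup>+z. ennreal (cmod z ^ (2 * k) * spherical_factor n E z) \<partial>lborel) =
      ennreal pi * (\<integral>\<^sup>+s. ennreal (?f s * indicator E s) * indicator {0..} s \<partial>lborel)"
    if [measurable]: "E \<in> sets borel" for E
    by (subst nn_integral_radial[symmetric])
      (auto intro!: nn_integral_cong simp: spherical_factor_def power_mult)
  show "(\<integral>\<^sup>+z. ennreal (cmod z ^ (2 * k) * spherical_factor n {..s} z) \<partial>lborel) =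
           ennreal (beta_const n k * bin_tail n k s)" if "s \<ge> 0"
  proof -
    have "(\<integral>\<^sup>+t. ennreal (?f t * indicator {..s} t) * indicator {0..} t \<partial>lborel) =
        (\<integral>\<^sup>+t. ennreal (?f t) * indicator {0..s} t \<partial>lborel)"
      by (intro nn_integral_cong) (auto split: split_indicator)
    also have "\<dots> = ennreal (?F s - ?F 0)"
      using that assms by (intro nn_integral_FTC_Icc DERIV_bin_tail_div) auto
    finally show ?thesis
      using beta_const_pos[OF assms] by (simp add: radial bin_tail_0 beta_const_def flip: ennreal_mult')
  qed
  have "(\<integral>\<^sup>+t. ennreal (?f t * indicator UNIV t) * indicator {0..} t \<partial>lborel) =
      ennreal (1 / (real (n - k) * real (n choose k)) - ?F 0)"
    unfolding indicator_UNIV mult_1_right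
  proof (rule nn_integral_FTC_atLeast)
    show "(?F \<longlongrightarrow> 1 / (real (n - k) * real (n choose k))) at_top"
      using assms by (intro tendsto_divide tendsto_bin_tail_at_top tendsto_const) auto
  qed (use assms DERIV_bin_tail_div in auto)
  then show "(\<integral>\<^sup>+z. ennreal (cmod z ^ (2 * k) * spherical_factor n UNIV z) \<partial>lborel) =
           ennreal (beta_const n k)"
    by (simp add: radial bin_tail_0 beta_const_def flip: ennreal_mult')
qed

definition moment :: "nat \<Rightarrow> nat \<Rightarrow> real set \<Rightarrow> real" where
  "moment n k E = (LINT z|lborel. cmod z ^ (2 * k) * spherical_factor n E z)"

lemma moment_eq:
  assumes "k < n"
  shows "s \<ge> 0 \<Longrightarrow> moment n k {..s} = beta_const n k * bin_tail n k s"
    and "moment n k UNIV = beta_const n k"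
proof -
  note pos = beta_const_pos[OF assms]
  have moment: "moment n k E = enn2real (\<integral>\<^sup>+z. ennreal (cmod z ^ (2 * k) * spherical_factor n E z) \<partial>lborel)"
    if "E \<in> sets borel" for E
    unfolding moment_def using that by (intro integral_eq_nn_integral) (auto simp: spherical_factor_nonneg)
  show "moment n k {..s} = beta_const n k * bin_tail n k s" if "s \<ge> 0"
    using pos bin_tail_nonneg[OF that, of n k] by (subst moment) (simp_all add: nn_integral_moment(1)[OF assms that])
  show "moment n k UNIV = beta_const n k"
    using pos by (simp add: moment nn_integral_moment(2)[OF assms])
qed

text \<open>The share of one coordinate in a term of the Vandermonde expansion times a conjugated
  term; a and b are the values of the two permutations at that coordinate.\<close>

definition spherical_kernel :: "nat \<Rightarrow> real set \<Rightarrow> nat \<Rightarrow> nat \<Rightarrow> complex \<Rightarrow> complex" where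
  "spherical_kernel n E a b z = z ^ a * cnj z ^ b * of_real (spherical_factor n E z)"

lemma borel_measurable_spherical_kernel [measurable]:
  "E \<in> sets borel \<Longrightarrow> spherical_kernel n E a b \<in> borel_measurable borel"
  unfolding spherical_kernel_def
  by (intro borel_measurable_times borel_measurable_power 
      measurable_compose[OF borel_measurable_spherical_factor] borel_measurable_continuous_onI
      continuous_intros) auto

text \<open>With a, b <= n - 1 the monomials are at most (1 + |z|^2)^(n - 1), so the kernel is
  dominated by (1 + |z|^2)^(-2), which is the weight for n = 1.\<close>

lemma integrable_spherical_kernel:
  assumes [measurable]: "E \<in> sets borel" and ab: "a < n" "b < n"
  shows "integrable lborel (spherical_kernel n E a b)"
proof (rule Bochner_Integration.integrable_bound)
  have "(\<integral>\<^sup>+z. ennreal (spherical_factor 1 UNIV z) \<partial>lborel) = ennreal (beta_const 1 0)"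
    using nn_integral_moment(2)[of 0 1] by simp
  then show "integrable lborel (spherical_factor 1 UNIV)"
    by (intro integrableI_nonneg) (auto simp: spherical_factor_nonneg)
  show "spherical_kernel n E a b \<in> borel_measurable lborel"
    by simp
  show "AE z in lborel. norm (spherical_kernel n E a b z) \<le> norm (spherical_factor 1 UNIV z)"
  proof (rule AE_I2)
    fix z :: complex
    \<comment> \<open>r bounds both 1 and |z|, so every power of |z| with exponent up to m is at
      most r^m, even where |z| < 1.\<close>
    define r where "r = sqrt (1 + (cmod z)\<^sup>2)"
    obtain m where n: "n = Suc m" "a \<le> m" "b \<le> m"
      using ab by (cases n) auto
    have r: "r \<ge> 1" "cmod z \<le> r" "r\<^sup>2 = 1 + (cmod z)\<^sup>2"
      by (auto simp: r_def real_le_rsqrt)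
    have pow_le: "cmod z ^ c \<le> r ^ m" if "c \<le> m" for c
      using power_mono[OF r(2), of c] power_increasing[OF that r(1)] by simp
    have "cmod z ^ a * cmod z ^ b \<le> r ^ m * r ^ m"
      using n r(1) by (intro mult_mono pow_le) auto
    also have "\<dots> = (1 + (cmod z)\<^sup>2) ^ m"
      by (metis power_mult_distrib power2_eq_square r(3))
    finally have "cmod z ^ a * cmod z ^ b / (1 + (cmod z)\<^sup>2) ^ (n + 1) \<le>
        (1 + (cmod z)\<^sup>2) ^ m / (1 + (cmod z)\<^sup>2) ^ (n + 1)"
      by (intro divide_right_mono) auto
    also have "\<dots> = 1 / (1 + (cmod z)\<^sup>2) ^ 2"
    proof -
      have "(1 + (cmod z)\<^sup>2) ^ (n + 1) = (1 + (cmod z)\<^sup>2) ^ m * (1 + (cmod z)\<^sup>2) ^ 2"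
        by (simp add: n power_add[symmetric])
      moreover have "1 + (cmod z)\<^sup>2 \<noteq> 0"
        by (metis add_nonneg_eq_0_iff zero_le_one zero_le_power2 zero_neq_one)
      ultimately show ?thesis by simp
    qed
    also have "\<dots> = norm (spherical_factor 1 UNIV z)"
      by (simp add: spherical_factor_def power2_eq_square)
    also have "cmod z ^ a * cmod z ^ b / (1 + (cmod z)\<^sup>2) ^ (n + 1) \<ge> norm (spherical_kernel n E a b z)"
    proof -
      have "norm (spherical_kernel n E a b z) = cmod z ^ a * cmod z ^ b * spherical_factor n E z"
        by (simp add: spherical_kernel_def norm_mult norm_power spherical_factor_nonneg)
      also have "\<dots> \<le> cmod z ^ a * cmod z ^ b * (1 / (1 + (cmod z)\<^sup>2) ^ (n + 1))"
        unfolding spherical_factor_def by (intro mult_left_mono divide_right_mono indicator_le_1) auto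
      finally show ?thesis by simp
    qed
    finally show "norm (spherical_kernel n E a b z) \<le> norm (spherical_factor 1 UNIV z)" .
  qed
qed

text \<open>A rotation by t preserves Lebesgue measure and the radial factor, and multiplies the
  kernel by the phase exp(i (a - b) t). A phase of -1 makes the integral equal to its own
  negative.\<close>

lemma integral_spherical_kernel_neq:
  assumes [measurable]: "E \<in> sets borel" and ab: "a \<noteq> b"
  shows "integral\<^sup>L lborel (spherical_kernel n E a b) = 0"
proof -
  \<comment> \<open>Solves (a - b) t = pi, which gives the phase -1.\<close>
  define t where "t = pi / (real a - real b)"
  define I where "I = integral\<^sup>L lborel (spherical_kernel n E a b)"
  have "cis t ^ a * cnj (cis t) ^ b = cis (real a * t + real b * - t)"
    by (simp add: Complex.DeMoivre cis_mult cis_cnj)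
  also have "real a * t + real b * - t = pi"
  proof -
    have "t * (real a - real b) = pi"
      using ab by (simp add: t_def)
    then show ?thesis by (simp add: algebra_simps)
  qed
  finally have phase: "cis t ^ a * cnj (cis t) ^ b = -1"
    by simp
  have "I = integral\<^sup>L (distr lborel borel ((*) (cis t))) (spherical_kernel n E a b)"
    by (simp add: I_def lborel_distr_cmult_unit)
  also have "\<dots> = (LINT z|lborel. spherical_kernel n E a b (cis t * z))"
    by (subst integral_distr) auto
  also have "\<dots> = (LINT z|lborel. - spherical_kernel n E a b z)"
  proof (rule Bochner_Integration.integral_cong[OF refl])
    fix z
    have "spherical_kernel n E a b (cis t * z) =
        (cis t ^ a * cnj (cis t) ^ b) * spherical_kernel n E a b z"
      by (simp add: spherical_kernel_def spherical_factor_def norm_mult power_mult_distrib mult_ac)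
    then show "spherical_kernel n E a b (cis t * z) = - spherical_kernel n E a b z"
      unfolding phase by simp
  qed
  also have "\<dots> = - I"
    by (simp add: I_def)
  finally show ?thesis
    by (simp add: I_def)
qed

lemma integral_spherical_kernel_same:
  "integral\<^sup>L lborel (spherical_kernel n E a a) = of_real (moment n a E)"
proof -
  have "spherical_kernel n E a a = (\<lambda>z. of_real (cmod z ^ (2 * a) * spherical_factor n E z))"
  proof
    fix z :: complex
    have "z ^ a * cnj z ^ a = of_real ((cmod z)\<^sup>2) ^ a"
      by (simp only: complex_norm_square power_mult_distrib)
    then show "spherical_kernel n E a a z = of_real (cmod z ^ (2 * a) * spherical_factor n E z)"
      by (simp add: spherical_kernel_def power_mult)
  qed
  then show ?thesis
    by (simp only: moment_def integral_complex_of_real)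
qed

text \<open>The weight contains |V|^2, that is \<open>V\<close> times its conjugate. Expanding both
  Vandermonde determinants turns each term into a product over coordinates, ready for
  Fubini.\<close>

lemma spherical_weight_expansion:
  "complex_of_real (spherical_weight n z * (\<Prod>k\<in>{1..n}. indicator E ((cmod (z k))\<^sup>2))) =
     (\<Sum>p | p permutes {..<n}. \<Sum>q | q permutes {..<n}. of_int (sign p * sign q) *
        (\<Prod>k<n. spherical_kernel n E (p k) (q k) (z (Suc k))))"
proof -
  define V where "V = (\<Prod>k<n. \<Prod>j<k. z (Suc k) - z (Suc j))"
  define W where "W = (\<Prod>k<n. spherical_factor n E (z (Suc k)))"
  \<comment> \<open>Coordinates are numbered from 1 while the permutations act on
    \<open>{..<n}\<close>.\<close>
  have shift: "(\<Prod>k\<in>{1..n}. f k) = (\<Prod>k<n. f (Suc k))" for f :: "nat \<Rightarrow> real" and n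
    by (rule prod.reindex_bij_witness[of _ Suc "\<lambda>k. k - 1"]) auto
  have shift': "(\<Prod>j\<in>{1..<Suc k}. f j) = (\<Prod>j<k. f (Suc j))" for f :: "nat \<Rightarrow> real" and k
    by (rule prod.reindex_bij_witness[of _ Suc "\<lambda>k. k - 1"]) auto
  have "spherical_weight n z * (\<Prod>k\<in>{1..n}. indicator E ((cmod (z k))\<^sup>2)) = (cmod V)\<^sup>2 * W"
    unfolding spherical_weight_def shift shift' V_def W_def spherical_factor_def
    by (simp add: prod_norm[symmetric] prod_power_distrib norm_minus_commute prod.distrib[symmetric] mult.assoc)
  also have "complex_of_real \<dots> = V * cnj V * of_real W"
    by (simp add: complex_norm_square[symmetric] del: of_real_power)
  also have "V = (\<Sum>p | p permutes {..<n}. of_int (sign p) * (\<Prod>k<n. z (Suc k) ^ p k))"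
    unfolding V_def by (rule vandermonde_sum_permutations)
  also have "cnj \<dots> = (\<Sum>q | q permutes {..<n}. of_int (sign q) * (\<Prod>k<n. cnj (z (Suc k)) ^ q k))"
    by simp
  also have "(\<Sum>p | p permutes {..<n}. of_int (sign p) * (\<Prod>k<n. z (Suc k) ^ p k)) * \<dots> * of_real W =
     (\<Sum>p | p permutes {..<n}. \<Sum>q | q permutes {..<n}.
        (of_int (sign p) * (\<Prod>k<n. z (Suc k) ^ p k)) * (of_int (sign q) * (\<Prod>k<n. cnj (z (Suc k)) ^ q k)) * of_real W)"
    unfolding sum_product unfolding sum_distrib_right ..
  also have "\<dots> = (\<Sum>p | p permutes {..<n}. \<Sum>q | q permutes {..<n}. of_int (sign p * sign q) *
        (\<Prod>k<n. spherical_kernel n E (p k) (q k) (z (Suc k))))"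
    by (intro sum.cong refl)
      (simp only: spherical_kernel_def W_def prod.distrib of_real_prod of_int_mult mult_ac)
  finally show ?thesis .
qed

text \<open>Each term of the expansion integrates to a product of integrals over one coordinate. If
  p and q differ, some factor vanishes by rotation; each of the n! diagonal terms has sign 1 and
  gives the same product of moments, reordered by p.\<close>

lemma has_bochner_integral_spherical_weight:
  assumes E[measurable]: "E \<in> sets borel"
  shows "has_bochner_integral (\<Pi>\<^sub>M j\<in>{1..n}. lborel)
     (\<lambda>z. spherical_weight n z * (\<Prod>k\<in>{1..n}. indicator E ((cmod (z k))\<^sup>2)))
     (fact n * (\<Prod>k<n. moment n k E))"
proof -
  interpret product_sigma_finite "\<lambda>_::nat. lborel :: complex measure" ..
  let ?M = "\<Pi>\<^sub>M j\<in>{1..n}. (lborel :: complex measure)"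
  let ?P = "{p. p permutes {..<n}}"
  define K where "K p q z = (\<Prod>k<n. spherical_kernel n E (p k) (q k) (z (Suc k)))"
    for p q :: "nat \<Rightarrow> nat" and z :: "nat \<Rightarrow> complex"
  have K_eq: "K p q = (\<lambda>z. \<Prod>i\<in>{1..n}. spherical_kernel n E (p (i - 1)) (q (i - 1)) (z i))" for p q
    unfolding K_def by (intro ext prod.reindex_bij_witness[of _ "\<lambda>k. k - 1" Suc]) auto
  have lt: "p k < n" if "p \<in> ?P" "k < n" for p k
    using that permutes_in_image[of p "{..<n}" k] by auto
  have int: "integrable lborel (spherical_kernel n E (p (i - 1)) (q (i - 1)))"
    if "p \<in> ?P" "q \<in> ?P" "i \<in> {1..n}" for p q i
    using that lt[of p "i - 1"] lt[of q "i - 1"] by (intro integrable_spherical_kernel) auto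
  have K_int: "integrable ?M (K p q)" if "p \<in> ?P" "q \<in> ?P" for p q
    unfolding K_eq using int[OF that] by (intro product_integrable_prod) auto
  have K_integral: "integral\<^sup>L ?M (K p q) =
      (\<Prod>k<n. integral\<^sup>L lborel (spherical_kernel n E (p k) (q k)))" if "p \<in> ?P" "q \<in> ?P" for p q
    unfolding K_eq using int[OF that]
    by (subst product_integral_prod) (auto intro!: prod.reindex_bij_witness[of _ Suc "\<lambda>k. k - 1"])
  have K_same: "integral\<^sup>L ?M (K p p) = of_real (\<Prod>k<n. moment n k E)" if "p \<in> ?P" for p
  proof -
    have "integral\<^sup>L ?M (K p p) = of_real (\<Prod>k<n. moment n (p k) E)"
      using K_integral[OF that that] by (simp add: integral_spherical_kernel_same)
    also have "(\<Prod>k<n. moment n (p k) E) = (\<Prod>k<n. moment n k E)"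
      using that prod.permute[of p "{..<n}" "\<lambda>k. moment n k E"] by (simp add: comp_def)
    finally show ?thesis .
  qed
  have K_neq: "integral\<^sup>L ?M (K p q) = 0" if pq: "p \<in> ?P" "q \<in> ?P" "p \<noteq> q" for p q
  proof -
    obtain k where "p k \<noteq> q k"
      using pq(3) by auto
    \<comment> \<open>Both permutations fix every point outside \<open>{..<n}\<close>, so they can
      only disagree below n.\<close>
    moreover from this have "k < n"
      using pq(1,2) by (metis lessThan_iff mem_Collect_eq permutes_not_in)
    ultimately show ?thesis
      unfolding K_integral[OF pq(1,2)] using E
      by (intro prod_zero bexI[of _ k] integral_spherical_kernel_neq) auto
  qed
  have fin: "finite ?P"
    by (rule finite_permutations) simp
  let ?f = "\<lambda>z. \<Sum>p\<in>?P. \<Sum>q\<in>?P. of_int (sign p * sign q) * K p q z"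
  have "has_bochner_integral ?M ?f (\<Sum>p\<in>?P. \<Sum>q\<in>?P. of_int (sign p * sign q) * integral\<^sup>L ?M (K p q))"
    by (intro has_bochner_integral_sum has_bochner_integral_mult_right has_bochner_integral_integrable K_int)
  also have "(\<Sum>p\<in>?P. \<Sum>q\<in>?P. of_int (sign p * sign q) * integral\<^sup>L ?M (K p q)) = (\<Sum>p\<in>?P. \<Sum>q\<in>?P. if q = p then of_real (\<Prod>k<n. moment n k E) else 0)"
    by (intro sum.cong refl) (auto simp: K_same K_neq sign_def simp del: One_nat_def)
  also have "\<dots> = (\<Sum>p\<in>?P. of_real (\<Prod>k<n. moment n k E))"
    using fin by simp
  also have "\<dots> = of_real (fact n * (\<Prod>k<n. moment n k E))"
    by (simp add: card_permutations[OF refl])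
  also have "?f = (\<lambda>z. complex_of_real (spherical_weight n z * (\<Prod>k\<in>{1..n}. indicator E ((cmod (z k))\<^sup>2))))"
    unfolding spherical_weight_expansion K_def ..
  finally have "has_bochner_integral ?M
      (\<lambda>z. complex_of_real (spherical_weight n z * (\<Prod>k\<in>{1..n}. indicator E ((cmod (z k))\<^sup>2))))
      (complex_of_real (fact n * (\<Prod>k<n. moment n k E)))" .
  \<comment> \<open>The expansion is complex-valued; taking real parts returns to the real
    integrand.\<close>
  from has_bochner_integral_bounded_linear[OF bounded_linear_Re this] show ?thesis
    by (simp only: Re_complex_of_real)
qed

lemma spherical_weight_nonneg: "spherical_weight n z \<ge> 0"
  by (auto simp: spherical_weight_def intro!: mult_nonneg_nonneg prod_nonneg divide_nonneg_nonneg)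

section \<open>The distribution of the maximum\<close>

text \<open>The case E = UNIV says that the total mass is 1 and thereby determines c. In the case E
  = \<open>{..s}\<close> the factors c, n! and the constants \<open>beta_const n k\<close> then
  cancel, leaving the binomial tails.\<close>

lemma measure_all_cmod_le:
  fixes Z :: "nat \<Rightarrow> 'a \<Rightarrow> complex"
  assumes "prob_space M"
    and distr: "distributed M (\<Pi>\<^sub>M j\<in>{1..n}. lborel) (\<lambda>\<omega>. \<lambda>j\<in>{1..n}. Z j \<omega>)
           (\<lambda>z. ennreal (c * spherical_weight n z))"
    and s: "s \<ge> 0"
  shows "measure M {\<omega>\<in>space M. \<forall>j\<in>{1..n}. (cmod (Z j \<omega>))\<^sup>2 \<le> s} = (\<Prod>k<n. bin_tail n k s)"
proof -
  interpret prob_space M by fact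
  let ?P = "\<Pi>\<^sub>M j\<in>{1..n}. (lborel :: complex measure)"
  let ?X = "\<lambda>\<omega>. \<lambda>j\<in>{1..n}. Z j \<omega>"
  define W where "W E z = spherical_weight n z * (\<Prod>k\<in>{1..n}. indicator E ((cmod (z k))\<^sup>2))"
    for E and z :: "nat \<Rightarrow> complex"
  have prob_eq: "ennreal (prob {\<omega>\<in>space M. \<forall>j\<in>{1..n}. (cmod (Z j \<omega>))\<^sup>2 \<in> E}) =
      (\<integral>\<^sup>+z. ennreal (c * W E z) \<partial>?P)" if E[measurable]: "E \<in> sets borel" for E
  proof -
    let ?A = "{z \<in> space ?P. \<forall>j\<in>{1..n}. (cmod (z j))\<^sup>2 \<in> E}"
    have "?A \<in> sets ?P"
      by measurable
    then have "emeasure M (?X -` ?A \<inter> space M) =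
        (\<integral>\<^sup>+z. ennreal (c * spherical_weight n z) * indicator ?A z \<partial>?P)"
      by (rule distributed_emeasure[OF distr])
    also have "\<dots> = (\<integral>\<^sup>+z. ennreal (c * W E z) \<partial>?P)"
    proof (rule nn_integral_cong)
      fix z assume z: "z \<in> space ?P"
      show "ennreal (c * spherical_weight n z) * indicator ?A z = ennreal (c * W E z)"
      proof (cases "z \<in> ?A")
        case True
        then have "(\<Prod>k\<in>{1..n}. indicator E ((cmod (z k))\<^sup>2)) = (1::real)"
          by (intro prod.neutral) auto
        with True show ?thesis by (simp add: W_def)
      next
        case False
        with z obtain j where "j \<in> {1..n}" "(cmod (z j))\<^sup>2 \<notin> E"
          by auto
        then have "(\<Prod>k\<in>{1..n}. indicator E ((cmod (z k))\<^sup>2)) = (0::real)"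
          by (intro prod_zero bexI[of _ j]) auto
        then have "W E z = 0"
          by (simp only: W_def mult_zero_right)
        with False show ?thesis by simp
      qed
    qed
    also have "?X -` ?A \<inter> space M = {\<omega>\<in>space M. \<forall>j\<in>{1..n}. (cmod (Z j \<omega>))\<^sup>2 \<in> E}"
      by (auto simp: space_PiM)
    finally show ?thesis
      by (simp add: emeasure_eq_measure)
  qed
  have total: "(\<integral>\<^sup>+z. ennreal (c * W UNIV z) \<partial>?P) = 1"
    using prob_eq[of UNIV] by (simp add: prob_space)
  \<comment> \<open>\<open>ennreal\<close> maps nonpositive reals to 0, so c <= 0 would give total
    mass 0.\<close>
  have c: "c > 0"
  proof (rule ccontr)
    assume "\<not> c > 0"
    then have "ennreal (c * W UNIV z) = 0" for z
      by (intro ennreal_neg) (simp add: W_def mult_nonpos_nonneg spherical_weight_nonneg)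
    with total show False by simp
  qed
  have W_nonneg: "0 \<le> W E z" for E z
    by (auto simp: W_def spherical_weight_nonneg intro!: mult_nonneg_nonneg prod_nonneg)
  have integral_W: "(\<integral>\<^sup>+z. ennreal (c * W E z) \<partial>?P) = ennreal (c * (fact n * (\<Prod>k<n. moment n k E)))"
    if "E \<in> sets borel" for E
  proof -
    have "has_bochner_integral ?P (\<lambda>z. c * W E z) (c * (fact n * (\<Prod>k<n. moment n k E)))"
      unfolding W_def using has_bochner_integral_spherical_weight[OF that, of n] by (rule has_bochner_integral_mult_right)
    then show ?thesis
      using c W_nonneg by (subst nn_integral_eq_integral) (auto simp: has_bochner_integral_iff)
  qed
  define b where "b = (\<Prod>k<n. beta_const n k)"
  have b: "b > 0"
    by (auto simp: b_def intro!: prod_pos beta_const_pos)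
  have "(\<Prod>k<n. moment n k UNIV) = b"
    by (simp add: b_def moment_eq)
  then have one: "c * (fact n * b) = 1"
    using total integral_W[of UNIV] c b by simp
  have "(\<Prod>k<n. moment n k {..s}) = b * (\<Prod>k<n. bin_tail n k s)"
    using s by (simp add: b_def moment_eq prod.distrib)
  then have "c * (fact n * (\<Prod>k<n. moment n k {..s})) = (\<Prod>k<n. bin_tail n k s)"
    using one by (metis mult.assoc mult_1)
  then have "ennreal (prob {\<omega>\<in>space M. \<forall>j\<in>{1..n}. (cmod (Z j \<omega>))\<^sup>2 \<in> {..s}}) =
      ennreal (\<Prod>k<n. bin_tail n k s)"
    by (simp only: prob_eq[of "{..s}"] integral_W[of "{..s}"] atMost_borel)
  moreover have "(\<Prod>k<n. bin_tail n k s) \<ge> 0"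
    using s by (intro prod_nonneg bin_tail_nonneg) auto
  ultimately show ?thesis
    by simp
qed

lemma cdf_max_cmod:
  fixes Z :: "nat \<Rightarrow> 'a \<Rightarrow> complex"
  assumes "prob_space M" and n: "n \<ge> 1"
    and distr: "distributed M (\<Pi>\<^sub>M j\<in>{1..n}. lborel) (\<lambda>\<omega>. \<lambda>j\<in>{1..n}. Z j \<omega>)
           (\<lambda>z. ennreal (c * spherical_weight n z))"
  defines "\<nu> \<equiv> distr M borel (\<lambda>\<omega>. 1 / sqrt (real n) * Max ((\<lambda>j. cmod (Z j \<omega>)) ` {1..n}))"
  shows "x > 0 \<Longrightarrow> cdf \<nu> x = (\<Prod>k<n. bin_head n (Suc k) (1 / x\<^sup>2))"
    and "x \<le> 0 \<Longrightarrow> cdf \<nu> x = 0"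
proof -
  interpret prob_space M by fact
  let ?Y = "\<lambda>\<omega>. 1 / sqrt (real n) * Max ((\<lambda>j. cmod (Z j \<omega>)) ` {1..n})"
  have Z[measurable]: "Z j \<in> borel_measurable M" if j: "j \<in> {1..n}" for j
  proof -
    have "(\<lambda>\<omega>. (\<lambda>j\<in>{1..n}. Z j \<omega>) j) \<in> measurable M lborel"
      by (rule measurable_compose[OF distributed_measurable[OF distr] measurable_component_singleton[OF j]])
    with j show ?thesis by simp
  qed
  have Y: "?Y \<in> borel_measurable M"
    by (intro borel_measurable_times borel_measurable_Max borel_measurable_const)
      (auto intro!: measurable_compose[OF Z])
  then interpret \<nu>: real_distribution \<nu>
    unfolding \<nu>_def by (rule real_distribution_distr)
  have cdf_nonneg_arg: "cdf \<nu> x = (\<Prod>k<n. bin_tail n k (real n * x\<^sup>2))" if x: "x \<ge> 0" for x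
  proof -
    \<comment> \<open>The maximum is over a nonempty set since n >= 1, and x >= 0 permits squaring
      both sides.\<close>
    have "?Y \<omega> \<le> x \<longleftrightarrow> (\<forall>j\<in>{1..n}. (cmod (Z j \<omega>))\<^sup>2 \<le> real n * x\<^sup>2)" for \<omega>
    proof -
      have "?Y \<omega> \<le> x \<longleftrightarrow> Max ((\<lambda>j. cmod (Z j \<omega>)) ` {1..n}) \<le> sqrt (real n) * x"
        using n by (simp add: field_simps)
      also have "\<dots> \<longleftrightarrow> (\<forall>j\<in>{1..n}. cmod (Z j \<omega>) \<le> sqrt (real n) * x)"
        using n by (subst Max_le_iff) auto
      also have "\<dots> \<longleftrightarrow> (\<forall>j\<in>{1..n}. (cmod (Z j \<omega>))\<^sup>2 \<le> (sqrt (real n) * x)\<^sup>2)"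
        using x by (intro ball_cong refl abs_le_square_iff[of "cmod _" "sqrt (real n) * x", simplified]) auto
      finally show ?thesis
        by (simp add: power_mult_distrib)
    qed
    then have "?Y -` {..x} \<inter> space M = {\<omega>\<in>space M. \<forall>j\<in>{1..n}. (cmod (Z j \<omega>))\<^sup>2 \<le> real n * x\<^sup>2}"
      by (simp only: vimage_def atMost_iff) blast
    then have "cdf \<nu> x = prob {\<omega>\<in>space M. \<forall>j\<in>{1..n}. (cmod (Z j \<omega>))\<^sup>2 \<le> real n * x\<^sup>2}"
      unfolding cdf_def \<nu>_def using Y by (subst measure_distr) auto
    also have "\<dots> = (\<Prod>k<n. bin_tail n k (real n * x\<^sup>2))"
      by (rule measure_all_cmod_le[OF assms(1) distr]) simp
    finally show ?thesis .
  qed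
  show "cdf \<nu> x = (\<Prod>k<n. bin_head n (Suc k) (1 / x\<^sup>2))" if x: "x > 0"
  proof -
    \<comment> \<open>With y = 1 / x^2 the argument n * x^2 is n / y.\<close>
    have "bin_tail n k (real n * x\<^sup>2) = bin_head n (n - k) (1 / x\<^sup>2)" if "k < n" for k
      using bin_tail_eq_bin_head[OF that, of "1 / x\<^sup>2"] x by simp
    then have "cdf \<nu> x = (\<Prod>k<n. bin_head n (n - k) (1 / x\<^sup>2))"
      using cdf_nonneg_arg[of x] x by simp
    \<comment> \<open>Reversing the order of the factors gives the factor at a fixed k the limit
      \<open>H_fun (Suc k)\<close>.\<close>
    also have "\<dots> = (\<Prod>k<n. bin_head n (Suc k) (1 / x\<^sup>2))"
      by (rule prod.reindex_bij_witness[of _ "\<lambda>k. n - Suc k" "\<lambda>k. n - Suc k"]) (auto simp: Suc_diff_Suc)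
    finally show ?thesis .
  qed
  show "cdf \<nu> x = 0" if "x \<le> 0"
  proof -
    \<comment> \<open>n >= 1 ensures that the product has a factor, and each factor is 0 at argument
      0.\<close>
    have "cdf \<nu> 0 = 0"
      using n by (simp add: cdf_nonneg_arg bin_tail_0)
    then show ?thesis
      using \<nu>.cdf_nondecreasing[OF that] \<nu>.cdf_nonneg[of x] by simp
  qed
qed

theorem theorem1:
  fixes M :: "nat \<Rightarrow> 'a measure"
    and Z :: "nat \<Rightarrow> nat \<Rightarrow> 'a \<Rightarrow> complex"
    and C :: "nat \<Rightarrow> real"
  assumes "\<And>n. n \<ge> 1 \<Longrightarrow> prob_space (M n)"
    and "\<And>n. n \<ge> 1 \<Longrightarrow>
           distributed (M n) (\<Pi>\<^sub>M j\<in>{1..n}. (lborel :: complex measure))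
             (\<lambda>\<omega>. \<lambda>j\<in>{1..n}. Z n j \<omega>)
             (\<lambda>z. ennreal (C n * spherical_weight n z))"
  shows "converges_weakly_to_cdf M
           (\<lambda>n \<omega>. 1 / sqrt (real n) * Max ((\<lambda>j. cmod (Z n j \<omega>)) ` {1..n})) H_cdf"
proof -
  let ?Y = "\<lambda>n \<omega>. 1 / sqrt (real n) * Max ((\<lambda>j. cmod (Z n j \<omega>)) ` {1..n})"
  \<comment> \<open>Convergence holds at every x, not only at continuity points of the limit. The
    index n = 0, about which nothing is assumed, is set aside by arguing eventually in n.\<close>
  have lim: "(\<lambda>n. cdf (distr (M n) borel (?Y n)) x) \<longlonglongrightarrow> H_cdf x" for x
  proof (cases "x > 0")
    case True
    have "\<forall>\<^sub>F n in sequentially. (\<Prod>k<n. bin_head n (Suc k) (1 / x\<^sup>2)) = cdf (distr (M n) borel (?Y n)) x"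
      using eventually_ge_at_top[of 1]
      by eventually_elim (rule cdf_max_cmod(1)[symmetric], use assms True in auto)
    moreover have "(\<lambda>n. \<Prod>k<n. bin_head n (Suc k) (1 / x\<^sup>2)) \<longlonglongrightarrow> H_cdf x"
      using prod_bin_head_tendsto[of "1 / x\<^sup>2"] True by (simp add: H_cdf_def)
    ultimately show ?thesis
      by (rule Lim_transform_eventually[rotated])
  next
    case False
    have "\<forall>\<^sub>F n in sequentially. cdf (distr (M n) borel (?Y n)) x = 0"
      using eventually_ge_at_top[of 1]
      by eventually_elim (rule cdf_max_cmod(2), use assms False in auto)
    with False show ?thesis
      by (simp add: H_cdf_def tendsto_eventually)
  qed
  obtain \<mu> where "real_distribution \<mu>" "cdf \<mu> = H_cdf"
    using real_distribution_H_cdf by blast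
  with lim show ?thesis
    unfolding converges_weakly_to_cdf_def weak_conv_m_def weak_conv_def by auto
qed

end
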